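(* Let $n_1,n_2>1$ and let $K_{n_1,n_2}$ be the complete bipartite graph of order $n_1+n_2$. For every vertex $a$ of $K_{n_1,n_2}$, $d_d(a)=2$.
   Context: A dominating set of a finite simple graph $G$ is a set $D\subseteq V(G)$ such that every vertex in $V(G)\setminus D$ is adjacent to some vertex of $D$. A minimal dominating set is a dominating set that does not properly contain any other dominating set. The domination degree of a vertex $a$ is $d_d(a)=\min\{|D| : D \text{ is a minimal dominating set of } G \text{ with } a\in D\}$. *)

theory Defs
  imports "Graph_Theory.Graph_Theory"
begin

text \<open>
  Finite simple graphs are the locale \<^locale>\<open>graph\<close> of \<^theory>\<open>Graph_Theory.Digraph\<close>: finite
  symmetric digraphs without loops or parallel arcs, with adjacency \<open>u \<rightarrow>\<^bsub>G\<^esub> v\<close>. (The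
  library constant \<open>dominates\<close> is just this adjacency relation.)
\<close>

definition dominating_set :: "('a, 'b) pre_digraph \<Rightarrow> 'a set \<Rightarrow> bool" where
  "dominating_set G D \<longleftrightarrow> D \<subseteq> verts G \<and> (\<forall>v \<in> verts G - D. \<exists>u \<in> D. v \<rightarrow>\<^bsub>G\<^esub> u)"

definition minimal_dominating_set :: "('a, 'b) pre_digraph \<Rightarrow> 'a set \<Rightarrow> bool" where
  "minimal_dominating_set G D \<longleftrightarrow> dominating_set G D \<and> (\<forall>D'. D' \<subset> D \<longrightarrow> \<not> dominating_set G D')"

text \<open>
  The set below is finite for finite \<open>G\<close>, and it is nonempty when \<open>G\<close> is a finite simple graph and
  \<open>a \<in> verts G\<close>, since any maximal independent set containing \<open>a\<close> is a minimal dominating set.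
  Outside these conditions the value is not meaningful.
\<close>
definition domination_degree :: "('a, 'b) pre_digraph \<Rightarrow> 'a \<Rightarrow> nat" where
  "domination_degree G a = Min {card D | D. minimal_dominating_set G D \<and> a \<in> D}"

end

theory Submission
  imports Defs
begin

text \<open>
  Two suitable vertices dominate, and one never does. In a complete bipartite graph, two vertices
  from opposite parts dominate everything, because each of them is adjacent to the whole part of
  the other; and every vertex \<open>a\<close> belongs to such a pair. Conversely, a single vertex \<open>x\<close> never
  dominates: as its part has at least two vertices, it contains another one, which is not adjacent
  to \<open>x\<close>. So 2 is the least cardinality of any dominating set. Since a dominating set of least
  cardinality is automatically minimal under inclusion, a pair through \<open>a\<close> is a minimal dominating
  set, and the minimum that defines \<^const>\<open>domination_degree\<close> is attained at it.
\<close>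

lemma dominating_set_subset_verts: "dominating_set G D \<Longrightarrow> D \<subseteq> verts G"
  by (simp add: dominating_set_def)

text \<open>
  A smallest dominating set is minimal, since a proper subset has smaller cardinality; and no
  minimal dominating set can be smaller than it. So a smallest dominating set through \<open>a\<close>
  determines the domination degree of \<open>a\<close>.
\<close>
lemma domination_degree_eq_card_smallest:
  assumes fin: "finite (verts G)" and D: "dominating_set G D" and a: "a \<in> D"
    and least: "\<And>D'. dominating_set G D' \<Longrightarrow> card D \<le> card D'"
  shows "domination_degree G a = card D"
proof -
  let ?S = "{card D | D. minimal_dominating_set G D \<and> a \<in> D}"
  have "finite D"
    using dominating_set_subset_verts[OF D] fin by (rule finite_subset)
  then have "minimal_dominating_set G D"
    using D least by (auto simp: minimal_dominating_set_def dest: psubset_card_mono leD)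
  then have attained: "card D \<in> ?S"
    using a by blast
  have lower: "card D \<le> k" if "k \<in> ?S" for k
    using that least by (auto simp: minimal_dominating_set_def)
  have "?S \<subseteq> {..card (verts G)}"
    using fin by (auto simp: minimal_dominating_set_def
        intro: card_mono dest: dominating_set_subset_verts)
  then have "finite ?S"
    by (rule finite_subset) simp
  then show ?thesis
    unfolding domination_degree_def using lower attained by (intro Min_eqI)
qed

text \<open>
  The hypothesis \<open>missed\<close> says that no vertex is universal, which is exactly what prevents a
  singleton from being dominating.
\<close>
lemma two_le_card_dominating_set:
  assumes fin: "finite (verts G)" and nonempty: "verts G \<noteq> {}"
    and missed: "\<And>x. x \<in> verts G \<Longrightarrow> \<exists>y \<in> verts G. y \<noteq> x \<and> \<not> y \<rightarrow>\<^bsub>G\<^esub> x"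
    and D: "dominating_set G D"
  shows "2 \<le> card D"
proof (rule ccontr)
  assume "\<not> 2 \<le> card D"
  then have "card D = 0 \<or> card D = 1"
    by linarith
  moreover have "card D \<noteq> 0"
  proof -
    have "D \<noteq> {}" using D nonempty by (auto simp: dominating_set_def)
    then show ?thesis
      using finite_subset[OF dominating_set_subset_verts[OF D] fin] by simp
  qed
  ultimately obtain x where x: "D = {x}"
    by (auto simp: card_1_singleton_iff)
  then have "x \<in> verts G"
    using dominating_set_subset_verts[OF D] by simp
  from missed[OF this] D x show False
    by (auto simp: dominating_set_def)
qed

lemma dominating_set_opposite_pair:
  assumes "verts G = U \<union> V" "arcs_ends G = U \<times> V \<union> V \<times> U" "u \<in> U" "v \<in> V"
  shows "dominating_set G {u, v}"
  using assms by (auto simp: dominating_set_def)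

theorem proposition3p10:
  fixes G :: "('a, 'b) pre_digraph" and n\<^sub>1 n\<^sub>2 :: nat
  assumes "n\<^sub>1 > 1" and "n\<^sub>2 > 1"
    and "complete_bipartite_digraph n\<^sub>1 n\<^sub>2 G"
  shows "\<forall>a \<in> verts G. domination_degree G a = 2"
proof
  fix a assume a: "a \<in> verts G"
  from assms obtain U V where verts: "verts G = U \<union> V" and disj: "U \<inter> V = {}"
    and arcs: "arcs_ends G = U \<times> V \<union> V \<times> U" and cards: "1 < card U" "1 < card V"
    by (auto simp: complete_bipartite_digraph_def)
  then have fin: "finite U" "finite V" and ne: "U \<noteq> {}" "V \<noteq> {}"
    by (auto intro: card_ge_0_finite)
  have other: "\<exists>y \<in> A. y \<noteq> x" if "1 < card A" for A :: "'a set" and x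
  proof -
    have "\<not> A \<subseteq> {x}" using that card_mono[of "{x}" A] by auto
    then show ?thesis by blast
  qed
  have missed: "\<exists>y \<in> verts G. y \<noteq> x \<and> \<not> y \<rightarrow>\<^bsub>G\<^esub> x" if "x \<in> verts G" for x
  proof (cases "x \<in> U")
    case True
    then show ?thesis using other[OF cards(1), of x] verts arcs disj by blast
  next
    case False
    then have "x \<in> V" using that verts by blast
    then show ?thesis using other[OF cards(2), of x] verts arcs disj by blast
  qed
  have fin_verts: "finite (verts G)"
    using verts fin by simp
  obtain u v where uv: "u \<in> U" "v \<in> V" "a \<in> {u, v}"
    using a verts ne by blast
  then have card_uv: "card {u, v} = 2"
    using disj by (auto simp: card_insert_if)
  have "2 \<le> card D" if "dominating_set G D" for D
    using fin_verts _ missed that by (rule two_le_card_dominating_set) (use a in blast)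
  then have "domination_degree G a = card {u, v}"
    using domination_degree_eq_card_smallest[OF fin_verts
        dominating_set_opposite_pair[OF verts arcs uv(1,2)] uv(3)] card_uv by simp
  then show "domination_degree G a = 2"
    using card_uv by simp
qed

end
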